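(* Let $q\geq 3$ be an integer, let $G\in\mathcal{A}(q)$ with maximum degree $t\geq q+2$, and let $f$ and $g$ be two proper $t$-colorings of $G$. Suppose that the subgraph $G(f,g,t)$ contains a cycle $C$ that is $t$-alternating with respect to $f$ and such that either the edges of $C$ receive at most $q+1$ distinct colors under $f$, or some vertex of $C$ has degree less than $t$ in $G$. Then there is a proper $t$-coloring $\overline f$ of $G$ such that $\overline f$ is $(q+1)$-equivalent to $f$ and $|M(\overline f,t)\cap M(g,t)|>|M(f,t)\cap M(g,t)|$.
   Context: Graphs are finite and simple. A $t$-coloring of $G$ is a map $f:E(G)\to\{1,\dots,t\}$; it is proper if adjacent edges get distinct colors. $M(f,j)$ is the set of edges of color $j$ under $f$. A path or cycle is $t$-alternating (with respect to $f$) if, of any two consecutive edges on it, one has color $t$. For an integer $q\geq 2$, $\mathcal{A}(q)$ is the set of graphs $G$ such that every subgraph $H$ of $G$ with $\Delta(H)\leq q$ has a proper $q$-edge-coloring. $G(f,g,t)$ is the subgraph of $G$ formed by the edge set $M(f,t)\triangle M(g,t)$ together with its endpoints. Two $t$-colorings differ by at most $n$ color classes if the number of colors $j$ with $M(f,j)\neq M(g,j)$ is at most $n$. Two proper $t$-colorings $f,h$ are $n$-equivalent if there is a sequence $f_0=f,f_1,\dots,f_k=h$ ($k\geq 1$) of proper $t$-colorings of $G$ with $f_i$ differing from $f_{i-1}$ by at most $n$ color classes for each $i$. *)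

theory Defs
  imports Main "HOL-Library.FuncSet"
begin

type_synonym 'a ugraph = "'a set \<times> 'a set set"

abbreviation uverts :: "'a ugraph \<Rightarrow> 'a set" where "uverts G \<equiv> fst G"
abbreviation uedges :: "'a ugraph \<Rightarrow> 'a set set" where "uedges G \<equiv> snd G"

definition simple_graph :: "'a ugraph \<Rightarrow> bool" where
  "simple_graph G \<longleftrightarrow> finite (uverts G) \<and> (\<forall>e\<in>uedges G. e \<subseteq> uverts G \<and> card e = 2)"

definition subgraph_of :: "'a ugraph \<Rightarrow> 'a ugraph \<Rightarrow> bool" where
  "subgraph_of H G \<longleftrightarrow> simple_graph H \<and> uverts H \<subseteq> uverts G \<and> uedges H \<subseteq> uedges G"

definition udegree :: "'a ugraph \<Rightarrow> 'a \<Rightarrow> nat" where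
  "udegree G v = card {e \<in> uedges G. v \<in> e}"

(* The inserted 0 only matters for the graph without vertices. *)
definition max_udegree :: "'a ugraph \<Rightarrow> nat" where
  "max_udegree G = Max (insert 0 (udegree G ` uverts G))"

(* Values of a coloring outside the edge set are irrelevant. *)
definition edge_coloring :: "'a ugraph \<Rightarrow> nat \<Rightarrow> ('a set \<Rightarrow> nat) \<Rightarrow> bool" where
  "edge_coloring G t f \<longleftrightarrow> f \<in> uedges G \<rightarrow> {1..t}"

definition proper_edge_coloring :: "'a ugraph \<Rightarrow> nat \<Rightarrow> ('a set \<Rightarrow> nat) \<Rightarrow> bool" where
  "proper_edge_coloring G t f \<longleftrightarrow> edge_coloring G t f \<and>
     (\<forall>e\<in>uedges G. \<forall>e'\<in>uedges G. e \<noteq> e' \<and> e \<inter> e' \<noteq> {} \<longrightarrow> f e \<noteq> f e')"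

definition color_class :: "'a ugraph \<Rightarrow> ('a set \<Rightarrow> nat) \<Rightarrow> nat \<Rightarrow> 'a set set" where
  "color_class G f j = {e \<in> uedges G. f e = j}"

definition class_A :: "nat \<Rightarrow> 'a ugraph set" where
  "class_A q = {G. simple_graph G \<and>
     (\<forall>H. subgraph_of H G \<and> max_udegree H \<le> q \<longrightarrow> (\<exists>h. proper_edge_coloring H q h))}"

definition diff_graph ::
  "'a ugraph \<Rightarrow> ('a set \<Rightarrow> nat) \<Rightarrow> ('a set \<Rightarrow> nat) \<Rightarrow> nat \<Rightarrow> 'a ugraph" where
  "diff_graph G f g t =
     (let D = sym_diff (color_class G f t) (color_class G g t) in (\<Union>D, D))"

(* A cycle is given by the list of its vertices in cyclic order. *)
definition cycle_edge :: "'a list \<Rightarrow> nat \<Rightarrow> 'a set" where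
  "cycle_edge C i = {C ! (i mod length C), C ! (Suc i mod length C)}"

definition cycle_edges :: "'a list \<Rightarrow> 'a set set" where
  "cycle_edges C = cycle_edge C ` {..<length C}"

definition cycle_in :: "'a ugraph \<Rightarrow> 'a list \<Rightarrow> bool" where
  "cycle_in G C \<longleftrightarrow> 3 \<le> length C \<and> distinct C \<and> set C \<subseteq> uverts G \<and> cycle_edges C \<subseteq> uedges G"

definition alternating_cycle :: "('a set \<Rightarrow> nat) \<Rightarrow> nat \<Rightarrow> 'a list \<Rightarrow> bool" where
  "alternating_cycle f t C \<longleftrightarrow>
     (\<forall>i<length C. f (cycle_edge C i) = t \<or> f (cycle_edge C (Suc i)) = t)"

definition differ_at_most ::
  "'a ugraph \<Rightarrow> nat \<Rightarrow> nat \<Rightarrow> ('a set \<Rightarrow> nat) \<Rightarrow> ('a set \<Rightarrow> nat) \<Rightarrow> bool" where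
  "differ_at_most G t n f g \<longleftrightarrow>
     card {j \<in> {1..t}. color_class G f j \<noteq> color_class G g j} \<le> n"

definition coloring_equivalent ::
  "'a ugraph \<Rightarrow> nat \<Rightarrow> nat \<Rightarrow> ('a set \<Rightarrow> nat) \<Rightarrow> ('a set \<Rightarrow> nat) \<Rightarrow> bool" where
  "coloring_equivalent G t n f h \<longleftrightarrow>
     (\<exists>k\<ge>1. \<exists>F :: nat \<Rightarrow> 'a set \<Rightarrow> nat.
        F 0 = f \<and> F k = h \<and> (\<forall>i\<le>k. proper_edge_coloring G t (F i)) \<and>
        (\<forall>i\<in>{1..k}. differ_at_most G t n (F i) (F (i - 1))))"

end

theory Submission
  imports Defs
begin

text \<open>
  Let M be the class of color t under f. If C has at most q + 1 colors, take q + 1 color classes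
  containing C: removing the symmetric difference of M and C from their union leaves maximum degree
  at most q, hence a q-colorable graph.

  Otherwise let v0 be a vertex of C missing a color, and go around C = v0 v1 v2 ... from v0 along its
  edge of color t. Consider colorings of G minus the edge x y, where x = v(2k) and y = v(2k+1), whose
  class t is the symmetric difference of M and the path v0 ... y. If x misses a color s, then y
  misses t, and recoloring q + 1 classes that contain t, s and the color of the next edge moves the
  uncolored edge two steps further; after a full turn it disappears. Such a partial coloring becomes
  a proper coloring of G by a t-r Kempe exchange at y, for any third color r, followed by recoloring
  q + 1 classes containing t, s and r. The class t of the result depends only on r, so two
  completions that use the same r and whose palettes differ in one color differ by at most q + 1
  classes. As q + 1 is at least 4, the palettes can be chosen in this way, and the
  completions of consecutive partial colorings are (q+1)-equivalent.
\<close>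

section \<open>Proper colorings of edge sets and recoloring in \<open>class_A\<close>\<close>

text \<open>Stated for an arbitrary edge set, so that colorings with an edge left uncolored, such as
  those of \<open>uedges G - {d}\<close>, need no graph of their own.\<close>

definition proper_on :: "nat \<Rightarrow> 'a set set \<Rightarrow> ('a set \<Rightarrow> nat) \<Rightarrow> bool" where
  "proper_on t D f \<longleftrightarrow> f \<in> D \<rightarrow> {1..t} \<and>
     (\<forall>e\<in>D. \<forall>e'\<in>D. e \<noteq> e' \<and> e \<inter> e' \<noteq> {} \<longrightarrow> f e \<noteq> f e')"

text \<open>Equivalently, every color outside \<open>S\<close> has the same class on
  \<open>D\<close> under both colorings. For a fixed \<open>S\<close> the pointwise form is
  transitive, which is how recolorings are composed.\<close>

definition agree_off :: "nat set \<Rightarrow> 'a set set \<Rightarrow> ('a set \<Rightarrow> nat) \<Rightarrow> ('a set \<Rightarrow> nat) \<Rightarrow> bool" where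
  "agree_off S D f g \<longleftrightarrow> (\<forall>e\<in>D. f e = g e \<or> (f e \<in> S \<and> g e \<in> S))"

lemma proper_edge_coloring_iff: "proper_edge_coloring G t f \<longleftrightarrow> proper_on t (uedges G) f"
  by (simp add: proper_edge_coloring_def edge_coloring_def proper_on_def)

lemma proper_onD:
  assumes "proper_on t D f" "e \<in> D" "e' \<in> D" "v \<in> e" "v \<in> e'" "f e = f e'"
  shows "e = e'"
  using assms unfolding proper_on_def by blast

lemma proper_on_range: "proper_on t D f \<Longrightarrow> e \<in> D \<Longrightarrow> f e \<in> {1..t}"
  unfolding proper_on_def by blast

lemma proper_on_subset: "proper_on t D f \<Longrightarrow> D' \<subseteq> D \<Longrightarrow> proper_on t D' f"
  unfolding proper_on_def by blast

text \<open>A proper coloring is injective on the edges at \<open>v\<close>. All degree bounds come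
  from here: each color of a palette that is absent at \<open>v\<close> lowers the bound by
  one.\<close>

lemma degree_le_colors:
  assumes "proper_on t D f" "B \<subseteq> D" "\<And>e. e \<in> B \<Longrightarrow> v \<in> e \<and> f e \<in> T" "finite T"
  shows "card B \<le> card T"
proof (rule card_inj_on_le)
  show "inj_on f B"
    using assms(2,3) proper_onD[OF assms(1)] by (intro inj_onI) blast
  show "f ` B \<subseteq> T" using assms(3) by blast
qed (rule assms(4))

lemma finite_uedges: "simple_graph G \<Longrightarrow> finite (uedges G)"
  unfolding simple_graph_def by (rule finite_subset[of _ "Pow (uverts G)"]) auto

text \<open>Membership in \<open>class_A q\<close> colors \<open>R\<close> with \<open>1..q\<close>,
  and a bijection renames these colors to \<open>Q\<close>. As \<open>\<sigma>\<close> avoids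
  \<open>Q\<close> on \<open>U\<close>, the two parts cannot conflict.\<close>

lemma class_A_recolor:
  assumes "G \<in> class_A q" "R \<subseteq> uedges G" "\<And>v. card {e \<in> R. v \<in> e} \<le> q"
    and "card Q = q" "finite Q" "Q \<subseteq> {1..t}"
    and "proper_on t U \<sigma>" "\<And>e. e \<in> U \<Longrightarrow> \<sigma> e \<notin> Q"
    and "U \<inter> R = {}"
  obtains h where "proper_on t (U \<union> R) h" "\<And>e. e \<in> U \<Longrightarrow> h e = \<sigma> e" "\<And>e. e \<in> R \<Longrightarrow> h e \<in> Q"
proof -
  let ?H = "(uverts G, R)"
  have G: "simple_graph G" using assms(1) by (simp add: class_A_def)
  have "subgraph_of ?H G"
    using G assms(2) unfolding subgraph_of_def simple_graph_def by auto
  moreover have "max_udegree ?H \<le> q"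
    using G assms(3) unfolding max_udegree_def simple_graph_def udegree_def by auto
  ultimately obtain h0 where "proper_edge_coloring ?H q h0"
    using assms(1) unfolding class_A_def by blast
  then have h0: "proper_on q R h0" by (simp add: proper_edge_coloring_iff)
  obtain b where b: "bij_betw b {1..q} Q"
    using assms(4,5) by (metis card_atLeastAtMost diff_Suc_1 finite_atLeastAtMost finite_same_card_bij)
  define h where "h e = (if e \<in> R then b (h0 e) else \<sigma> e)" for e
  have hR: "h e \<in> Q" if "e \<in> R" for e
    using that b proper_on_range[OF h0 that] by (auto simp: h_def bij_betw_def)
  have hU: "h e = \<sigma> e" if "e \<in> U" for e
    using that assms(9) by (auto simp: h_def)
  have inj: "inj_on b {1..q}" using b by (simp add: bij_betw_def)
  have "proper_on t (U \<union> R) h"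
    unfolding proper_on_def
  proof (intro conjI ballI impI)
    show "h \<in> U \<union> R \<rightarrow> {1..t}"
      using hR hU assms(6) proper_on_range[OF assms(7)] by fastforce
  next
    fix e e' assume e: "e \<in> U \<union> R" "e' \<in> U \<union> R" "e \<noteq> e' \<and> e \<inter> e' \<noteq> {}"
    consider "e \<in> U" "e' \<in> U" | "e \<in> R" "e' \<in> R" | "e \<in> U" "e' \<in> R" | "e \<in> R" "e' \<in> U"
      using e by blast
    then show "h e \<noteq> h e'"
    proof cases
      case 1 then show ?thesis using e hU assms(7) unfolding proper_on_def by metis
    next
      case 2
      then have "h0 e \<noteq> h0 e'" using e h0 unfolding proper_on_def by blast
      then show ?thesis
        using 2 proper_on_range[OF h0] inj unfolding h_def inj_on_def by auto
    next
      case 3 then show ?thesis using hU hR assms(8) by metis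
    next
      case 4 then show ?thesis using hU hR assms(8) by metis
    qed
  qed
  then show thesis using that hU hR by blast
qed

section \<open>Kempe exchanges and colorings with one uncolored edge\<close>

text \<open>Exchange \<open>t\<close> and \<open>r\<close> on the component of \<open>y\<close> in
  the subgraph of these two colors: since \<open>y\<close> misses \<open>t\<close> before, it misses
  \<open>r\<close> afterwards.\<close>

lemma kempe_swap_at:
  assumes \<rho>: "proper_on t D \<rho>" and y: "\<And>e. e \<in> D \<Longrightarrow> y \<in> e \<Longrightarrow> \<rho> e \<noteq> t"
    and D: "\<And>e. e \<in> D \<Longrightarrow> card e = 2" and rt: "r \<in> {1..t}" "t \<noteq> r"
  obtains \<rho>' where "proper_on t D \<rho>'" "agree_off {t, r} D \<rho> \<rho>'"
    "\<And>e. e \<in> D \<Longrightarrow> y \<in> e \<Longrightarrow> \<rho>' e \<noteq> r"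
proof -
  \<comment> \<open>\<open>V\<close> is the vertex set of the Kempe component of \<open>y\<close>.
    The exchange is formulated through vertices: an edge of a third color may have just one end in
    \<open>V\<close>, but \<open>sw\<close> fixes its color.\<close>
  define L where "L = {(u, v). {u, v} \<in> D \<and> \<rho> {u, v} \<in> {t, r}}"
  define V where "V = L\<^sup>* `` {y}"
  define sw where "sw c = (if c = t then r else if c = r then t else c)" for c
  define \<rho>' where "\<rho>' e = (if e \<inter> V \<noteq> {} then sw (\<rho> e) else \<rho> e)" for e
  have yV: "y \<in> V" by (simp add: V_def)
  have closed: "v \<in> V" if "e \<in> D" "\<rho> e \<in> {t, r}" "u \<in> e" "v \<in> e" "u \<in> V" for e u v
  proof (cases "u = v")
    case False
    then have "e = {u, v}" using D[OF that(1)] that(3,4) by (auto simp: card_2_iff)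
    then have "(u, v) \<in> L" using that unfolding L_def by auto
    then show ?thesis using that(5) unfolding V_def by (auto intro: rtrancl_into_rtrancl)
  qed (use that in simp)
  have sw_other: "sw c = c" if "c \<notin> {t, r}" for c using that by (simp add: sw_def)
  have sw_in: "sw c \<in> {t, r} \<longleftrightarrow> c \<in> {t, r}" for c by (auto simp: sw_def)
  have sw_inj: "sw c = sw c' \<longleftrightarrow> c = c'" for c c' using rt by (auto simp: sw_def)
  \<comment> \<open>By \<open>closed\<close>, an edge colored \<open>t\<close> or \<open>r\<close>
    has both ends in \<open>V\<close> or none. So the edges at a common vertex are all mapped by
    \<open>sw\<close> or all kept, and injectivity of \<open>sw\<close> preserves
    properness.\<close>
  have at: "\<rho>' e = (if v \<in> V then sw (\<rho> e) else \<rho> e)" if "e \<in> D" "v \<in> e" for e v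
    using that closed[OF that(1)] sw_other[of "\<rho> e"] unfolding \<rho>'_def by (cases "\<rho> e \<in> {t, r}") auto
  have "proper_on t D \<rho>'"
    unfolding proper_on_def
  proof (intro conjI ballI impI)
    show "\<rho>' \<in> D \<rightarrow> {1..t}"
      using proper_on_range[OF \<rho>] rt by (fastforce simp: \<rho>'_def sw_def)
  next
    fix e e' assume e: "e \<in> D" "e' \<in> D" "e \<noteq> e' \<and> e \<inter> e' \<noteq> {}"
    then obtain v where v: "v \<in> e" "v \<in> e'" by blast
    have "\<rho> e \<noteq> \<rho> e'" using e \<rho> unfolding proper_on_def by blast
    then show "\<rho>' e \<noteq> \<rho>' e'" using at[OF e(1) v(1)] at[OF e(2) v(2)] by (simp add: sw_inj)
  qed
  moreover have "agree_off {t, r} D \<rho> \<rho>'"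
    unfolding agree_off_def \<rho>'_def using sw_other sw_in by metis
  moreover have "\<rho>' e \<noteq> r" if "e \<in> D" "y \<in> e" for e
    using at[OF that] y[OF that] yV rt by (auto simp: sw_def)
  ultimately show thesis using that by blast
qed

text \<open>The \<open>q\<close> classes of \<open>S - {t}\<close> have a free color at both ends of
  \<open>d\<close>, namely \<open>s\<close> at \<open>x\<close> and \<open>r\<close> at
  \<open>y\<close>. Hence adding \<open>d\<close> to them keeps the degrees at most
  \<open>q\<close>, and class \<open>t\<close> stays untouched.\<close>

lemma complete_coloring:
  assumes A: "G \<in> class_A q" and d: "d \<in> uedges G" "d = {x, y}"
    and \<rho>: "proper_on t (uedges G - {d}) \<rho>"
    and x: "\<And>e. e \<in> uedges G - {d} \<Longrightarrow> x \<in> e \<Longrightarrow> \<rho> e \<noteq> s"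
    and y: "\<And>e. e \<in> uedges G - {d} \<Longrightarrow> y \<in> e \<Longrightarrow> \<rho> e \<noteq> r"
    and S: "S \<subseteq> {1..t}" "card S = q + 1" "t \<in> S" "s \<in> S" "r \<in> S" "s \<noteq> t" "r \<noteq> t"
  obtains h where "proper_on t (uedges G) h" "agree_off S (uedges G - {d}) \<rho> h" "h d \<in> S" "h d \<noteq> t"
    "\<And>e. e \<in> uedges G - {d} \<Longrightarrow> h e = t \<longleftrightarrow> \<rho> e = t"
proof -
  let ?E = "uedges G" and ?Q = "S - {t}"
  let ?R = "insert d {e \<in> ?E - {d}. \<rho> e \<in> ?Q}" and ?U = "{e \<in> ?E - {d}. \<rho> e \<notin> ?Q}"
  have finS: "finite S" using S(1) finite_subset by blast
  have fin: "finite ?E" using A finite_uedges unfolding class_A_def by blast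
  have cQ: "card ?Q = q" using S finS by simp
  have deg: "card {e \<in> ?R. v \<in> e} \<le> q" for v
  proof (cases "v \<in> d")
    case False
    have "card {e \<in> ?R. v \<in> e} \<le> card ?Q"
      by (rule degree_le_colors[OF \<rho>, of _ v]) (use False finS in auto)
    then show ?thesis using cQ by simp
  next
    case True
    \<comment> \<open>The color of the palette absent at this end of \<open>d\<close>; it makes up
      for the extra edge \<open>d\<close>.\<close>
    define c where "c = (if v = x then s else r)"
    have c: "c \<in> ?Q" using S by (simp add: c_def)
    have "card {e \<in> ?E - {d}. \<rho> e \<in> ?Q \<and> v \<in> e} \<le> card (?Q - {c})"
      by (rule degree_le_colors[OF \<rho>, of _ v]) (use True d x y finS in \<open>auto simp: c_def\<close>)
    also have "\<dots> = q - 1" using c cQ finS by simp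
    finally have le: "card {e \<in> ?E - {d}. \<rho> e \<in> ?Q \<and> v \<in> e} \<le> q - 1" .
    have "{e \<in> ?R. v \<in> e} = insert d {e \<in> ?E - {d}. \<rho> e \<in> ?Q \<and> v \<in> e}" using True by auto
    moreover have "q > 0" using c cQ finS by (metis card_gt_0_iff empty_iff finite_Diff)
    ultimately show ?thesis using le fin by simp
  qed
  obtain h where h: "proper_on t (?U \<union> ?R) h" "\<And>e. e \<in> ?U \<Longrightarrow> h e = \<rho> e" "\<And>e. e \<in> ?R \<Longrightarrow> h e \<in> ?Q"
  proof (rule class_A_recolor[OF A _ deg cQ _ _ proper_on_subset[OF \<rho>, of ?U]])
    show "finite ?Q" "?Q \<subseteq> {1..t}" using finS S by auto
  qed (use d in auto)
  have "?U \<union> ?R = ?E" using d by auto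
  moreover have "h e = t \<longleftrightarrow> \<rho> e = t" if "e \<in> ?E - {d}" for e
  proof (cases "\<rho> e \<in> ?Q")
    case True
    then have "h e \<in> ?Q" using that by (intro h(3)) simp
    then show ?thesis using True by auto
  next
    case False
    then show ?thesis using that h(2)[of e] by simp
  qed
  moreover have "agree_off S (?E - {d}) \<rho> h"
    unfolding agree_off_def using h(2,3) by fastforce
  ultimately show thesis using that h by auto
qed

text \<open>Since \<open>y\<close> misses \<open>t\<close>, the edge \<open>e\<close> can take color
  \<open>t\<close> once the edges of color \<open>t\<close> at \<open>z\<close> are uncolored. Then
  \<open>d\<close> fits into the classes of \<open>S - {t}\<close>: \<open>s\<close> is free at
  \<open>x\<close>, and the old color of \<open>e\<close> is free at \<open>y\<close>. The uncolored
  edges form a set \<open>B\<close> so that the case of no such edge at \<open>z\<close>, which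
  closes the cycle, is covered as well.\<close>

lemma shift_uncolored:
  assumes A: "G \<in> class_A q" and d: "d \<in> uedges G" "d = {x, y}"
    and \<rho>: "proper_on t (uedges G - {d}) \<rho>"
    and x: "\<And>e. e \<in> uedges G - {d} \<Longrightarrow> x \<in> e \<Longrightarrow> \<rho> e \<noteq> s"
    and y: "\<And>e. e \<in> uedges G - {d} \<Longrightarrow> y \<in> e \<Longrightarrow> \<rho> e \<noteq> t"
    and S: "S \<subseteq> {1..t}" "card S = q + 1" "t \<in> S" "s \<in> S" "s \<noteq> t"
    and e: "e \<in> uedges G" "e \<noteq> d" "e = {y, z}" "\<rho> e \<in> S"
    and B: "B = {e' \<in> uedges G - {d}. \<rho> e' = t \<and> z \<in> e'}"
  obtains \<rho>' where "proper_on t (uedges G - B) \<rho>'"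
    "\<rho>' d \<in> S" "agree_off S (uedges G - B - {d}) \<rho> \<rho>'"
    "\<And>e'. e' \<in> uedges G - B \<Longrightarrow> \<rho>' e' = t \<longleftrightarrow> e' = e \<or> (e' \<noteq> d \<and> \<rho> e' = t)"
    "z \<notin> d \<Longrightarrow> \<exists>s'\<in>S - {t}. \<forall>e'\<in>uedges G - B. z \<in> e' \<longrightarrow> \<rho>' e' \<noteq> s'"
proof -
  let ?E = "uedges G" and ?Q = "S - {t}"
  let ?R = "insert d {e' \<in> ?E - {d, e}. \<rho> e' \<in> ?Q}"
  let ?U = "insert e {e' \<in> ?E - B - {d}. \<rho> e' \<notin> ?Q}"
  have finS: "finite S" using S(1) finite_subset by blast
  have fin: "finite ?E" using A finite_uedges unfolding class_A_def by blast
  have cQ: "card ?Q = q" using S finS by simp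
  have et: "\<rho> e \<noteq> t" using y e by blast
  have sQ: "s \<in> ?Q" "\<rho> e \<in> ?Q" using S e et by auto
  have q0: "q > 0" using sQ cQ finS by (metis card_gt_0_iff empty_iff finite_Diff)
  have only_e: "e' = e" if "e' \<in> ?E - {d}" "v \<in> e'" "v \<in> e" "\<rho> e' = \<rho> e" for e' v
    using proper_onD[OF \<rho>, of e' e v] that e by auto
  have deg: "card {e' \<in> ?R. v \<in> e'} \<le> q" for v
  proof (cases "v \<in> d")
    case False
    have "card {e' \<in> ?R. v \<in> e'} \<le> card ?Q"
      by (rule degree_le_colors[OF \<rho>, of _ v]) (use False finS in auto)
    then show ?thesis using cQ by simp
  next
    case True
    define c where "c = (if v = x then s else \<rho> e)"
    have c: "c \<in> ?Q" using sQ by (simp add: c_def)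
    have "card {e' \<in> ?E - {d, e}. \<rho> e' \<in> ?Q \<and> v \<in> e'} \<le> card (?Q - {c})"
    proof (rule degree_le_colors[OF \<rho>, of _ v])
      fix e' assume e': "e' \<in> {e' \<in> ?E - {d, e}. \<rho> e' \<in> ?Q \<and> v \<in> e'}"
      have "\<rho> e' \<noteq> c"
        using e' x[of e'] only_e[of e' v] True d(2) e(3) by (auto simp: c_def)
      then show "v \<in> e' \<and> \<rho> e' \<in> ?Q - {c}" using e' by auto
    qed (use finS in auto)
    also have "\<dots> = q - 1" using c cQ finS by simp
    finally have le: "card {e' \<in> ?E - {d, e}. \<rho> e' \<in> ?Q \<and> v \<in> e'} \<le> q - 1" .
    have "{e' \<in> ?R. v \<in> e'} = insert d {e' \<in> ?E - {d, e}. \<rho> e' \<in> ?Q \<and> v \<in> e'}" using True by auto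
    then show ?thesis using le fin q0 by simp
  qed
  \<comment> \<open>The only edges of color \<open>t\<close> that meet \<open>e\<close> are those in
    \<open>B\<close>: at \<open>y\<close> there are none by assumption.\<close>
  have noB: "\<rho> e' \<noteq> t" if "e' \<in> ?E - B - {d}" "e' \<inter> e \<noteq> {}" for e'
    using that y[of e'] e(3) unfolding B by auto
  have "proper_on t ?U (\<rho>(e := t))"
    unfolding proper_on_def
  proof (intro conjI ballI impI)
    show "\<rho>(e := t) \<in> ?U \<rightarrow> {1..t}"
      using proper_on_range[OF \<rho>] S by (auto simp: Pi_iff)
  next
    fix e1 e2 assume 12: "e1 \<in> ?U" "e2 \<in> ?U" "e1 \<noteq> e2 \<and> e1 \<inter> e2 \<noteq> {}"
    consider "e1 = e" "e2 \<in> ?E - B - {d}" "e2 \<noteq> e" | "e2 = e" "e1 \<in> ?E - B - {d}" "e1 \<noteq> e"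
      | "e1 \<noteq> e" "e2 \<noteq> e" "e1 \<in> ?E - {d}" "e2 \<in> ?E - {d}"
      using 12 by blast
    then show "(\<rho>(e := t)) e1 \<noteq> (\<rho>(e := t)) e2"
    proof cases
      case 1 then show ?thesis using noB[of e2] 12(3) by (simp add: Int_commute)
    next
      case 2 then show ?thesis using noB[of e1] 12(3) by simp
    next
      case 3
      then have "\<rho> e1 \<noteq> \<rho> e2" using \<rho> 12(3) unfolding proper_on_def by blast
      then show ?thesis using 3 by simp
    qed
  qed
  then obtain h where h: "proper_on t (?U \<union> ?R) h" "\<And>e'. e' \<in> ?U \<Longrightarrow> h e' = (\<rho>(e := t)) e'"
      "\<And>e'. e' \<in> ?R \<Longrightarrow> h e' \<in> ?Q"
  proof (rule class_A_recolor[OF A _ deg cQ, rotated 3])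
    show "finite ?Q" "?Q \<subseteq> {1..t}" using finS S by auto
  qed (use d e in auto)
  have UR: "?U \<union> ?R = ?E - B" using d e et unfolding B by auto
  have ht: "h e' = t \<longleftrightarrow> e' = e \<or> (e' \<noteq> d \<and> \<rho> e' = t)" if "e' \<in> ?E - B" for e'
  proof (cases "e' \<in> ?U")
    case True then show ?thesis using h(2)[OF True] e(2) by auto
  next
    case False
    then have "e' \<in> ?R" using that UR by blast
    then show ?thesis using h(3) False by fastforce
  qed
  moreover have "agree_off S (?E - B - {d}) \<rho> h"
    unfolding agree_off_def
  proof
    fix e' assume e': "e' \<in> ?E - B - {d}"
    show "\<rho> e' = h e' \<or> \<rho> e' \<in> S \<and> h e' \<in> S"
    proof (cases "e' \<in> ?U")
      case True then show ?thesis using h(2)[OF True] e S by (cases "e' = e") auto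
    next
      case False
      then have "e' \<in> ?R" using e' UR by blast
      then show ?thesis using h(3)[of e'] e' by auto
    qed
  qed
  moreover have "\<exists>s'\<in>?Q. \<forall>e'\<in>?E - B. z \<in> e' \<longrightarrow> h e' \<noteq> s'" if zd: "z \<notin> d"
  proof (rule ccontr)
    let ?Z = "{e' \<in> ?R. z \<in> e'}"
    assume "\<not> ?thesis"
    then have all: "\<exists>e'\<in>?E - B. z \<in> e' \<and> h e' = s'" if "s' \<in> ?Q" for s' using that by blast
    \<comment> \<open>If all \<open>q\<close> colors of \<open>?Q\<close> occurred at
      \<open>z\<close>, they would occur on edges of \<open>?R\<close>. But \<open>?R\<close> has at
      most \<open>q - 1\<close> edges at \<open>z\<close>, because \<open>e\<close> has moved to
      class \<open>t\<close> and \<open>d\<close> does not contain \<open>z\<close>.\<close>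
    have "?Q \<subseteq> h ` ?Z"
    proof
      fix s' assume s': "s' \<in> ?Q"
      then obtain e' where e': "e' \<in> ?E - B" "z \<in> e'" "h e' = s'" using all by blast
      have "e' \<notin> ?U"
      proof
        assume "e' \<in> ?U"
        then show False using h(2)[of e'] s' e' by (auto split: if_splits)
      qed
      then show "s' \<in> h ` ?Z" using e' UR by blast
    qed
    moreover have finZ: "finite ?Z" using fin by auto
    ultimately have "q \<le> card ?Z" using surj_card_le[of ?Z ?Q h] cQ by simp
    moreover have "card ?Z \<le> card (?Q - {\<rho> e})"
    proof (rule degree_le_colors[OF \<rho>, of _ z])
      fix e' assume "e' \<in> ?Z"
      then show "z \<in> e' \<and> \<rho> e' \<in> ?Q - {\<rho> e}"
        using zd only_e[of e' z] e(3) by auto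
    qed (use zd finS in auto)
    moreover have "card (?Q - {\<rho> e}) = q - 1" using sQ cQ finS by simp
    ultimately show False using q0 by simp
  qed
  moreover have "h d \<in> S" using h(3) by blast
  ultimately show thesis using that h(1) UR by auto
qed

section \<open>Equivalence of colorings\<close>

lemma differ_at_mostI:
  assumes "agree_off T (uedges G) a b" "finite T" "card T \<le> n"
  shows "differ_at_most G t n a b"
proof -
  have "{j \<in> {1..t}. color_class G a j \<noteq> color_class G b j} \<subseteq> T"
    using assms(1) unfolding agree_off_def color_class_def by fastforce
  then show ?thesis
    unfolding differ_at_most_def using assms(2,3) by (meson card_mono le_trans)
qed

lemma coloring_equivalent_refl:
  "proper_edge_coloring G t f \<Longrightarrow> coloring_equivalent G t n f f"
  unfolding coloring_equivalent_def differ_at_most_def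
  by (intro exI[of _ 1] conjI exI[of _ "\<lambda>_. f"]) auto

lemma coloring_equivalent_step:
  fixes G :: "'a ugraph"
  assumes a: "proper_edge_coloring G t a" and ab: "differ_at_most G t n a b"
    and bc: "coloring_equivalent G t n b c"
  shows "coloring_equivalent G t n a c"
proof -
  obtain k :: nat and F :: "nat \<Rightarrow> 'a set \<Rightarrow> nat" where F: "F 0 = b" "F k = c" "\<forall>i\<le>k. proper_edge_coloring G t (F i)"
      "\<forall>i\<in>{1..k}. differ_at_most G t n (F i) (F (i - 1))"
    using bc unfolding coloring_equivalent_def by (elim exE conjE)
  define F' where "F' i = (case i of 0 \<Rightarrow> a | Suc j \<Rightarrow> F j)" for i
  \<comment> \<open>The definition compares each term with its predecessor, so the new first step is
    needed in the reverse direction.\<close>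
  have "{j \<in> {1..t}. color_class G b j \<noteq> color_class G a j}
      = {j \<in> {1..t}. color_class G a j \<noteq> color_class G b j}" by blast
  then have "differ_at_most G t n b a"
    using ab unfolding differ_at_most_def by simp
  then have "differ_at_most G t n (F' i) (F' (i - 1))" if "i \<in> {1..Suc k}" for i
    using that F(1) bspec[OF F(4), of "i - 1"] by (cases "i = 1") (auto simp: F'_def split: nat.split)
  moreover have "proper_edge_coloring G t (F' i)" if "i \<le> Suc k" for i
    using that a F(3) by (auto simp: F'_def split: nat.split)
  moreover have "F' 0 = a" "F' (Suc k) = c" using F by (auto simp: F'_def)
  ultimately show ?thesis unfolding coloring_equivalent_def by (intro exI[of _ "Suc k"]) auto
qed

text \<open>
  Here \<open>h\<close> completes the partial coloring \<open>\<rho>\<close> within the palette \<open>S\<close>. One color of \<open>S\<close> is exchanged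
  for \<open>a\<close>, while \<open>t\<close>, \<open>s\<close> and the Kempe color \<open>r\<close> are kept.
\<close>

lemma change_palette:
  assumes A: "G \<in> class_A q" and q: "q \<ge> 3" and d: "d \<in> uedges G" "d = {x, y}"
    and \<rho>: "proper_on t (uedges G - {d}) \<rho>"
    and x: "\<And>e. e \<in> uedges G - {d} \<Longrightarrow> x \<in> e \<Longrightarrow> \<rho> e \<noteq> s"
    and y: "\<And>e. e \<in> uedges G - {d} \<Longrightarrow> y \<in> e \<Longrightarrow> \<rho> e \<noteq> t"
    and S: "S \<subseteq> {1..t}" "card S = q + 1" "t \<in> S" "s \<in> S" "s \<noteq> t"
    and h: "coloring_equivalent G t (q + 1) h f" "agree_off S (uedges G - {d}) \<rho> h" "h d \<in> S"
    and a: "a \<in> {1..t}"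
  obtains S' h' where "S' \<subseteq> {1..t}" "card S' = q + 1" "t \<in> S'" "s \<in> S'" "a \<in> S'"
    "coloring_equivalent G t (q + 1) h' f" "agree_off S' (uedges G - {d}) \<rho> h'" "h' d \<in> S'"
proof (cases "a \<in> S")
  case True then show thesis using that S h by blast
next
  case False
  have finS: "finite S" using S(1) finite_subset by blast
  have "card (S - {t, s}) = q - 1" using S finS by (simp add: card_Diff_subset)
  then obtain r where r: "r \<in> S" "r \<noteq> t" "r \<noteq> s"
    using q by (cases "S - {t, s} = {}") auto
  have "card (S - {t, s, r}) = q - 2" using S finS r by (simp add: card_Diff_subset)
  \<comment> \<open>\<open>b\<close> is the color to be given up. The colors \<open>t\<close>,
    \<open>s\<close>, \<open>r\<close>, \<open>b\<close> are distinct members of \<open>S\<close>,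
    which is possible as \<open>q + 1\<close> is at least 4.\<close>
  then obtain b where b: "b \<in> S" "b \<notin> {t, s, r}"
    using q by (cases "S - {t, s, r} = {}") auto
  define S' where "S' = insert a (S - {b})"
  have S': "S' \<subseteq> {1..t}" "card S' = q + 1" "t \<in> S'" "s \<in> S'" "r \<in> S'" "a \<in> S'"
    using S a b r False finS by (auto simp: S'_def)
  have D2: "card e = 2" if "e \<in> uedges G - {d}" for e
    using A that unfolding class_A_def simple_graph_def by blast
  obtain \<rho>' where \<rho>': "proper_on t (uedges G - {d}) \<rho>'" "agree_off {t, r} (uedges G - {d}) \<rho> \<rho>'"
    "\<And>e. e \<in> uedges G - {d} \<Longrightarrow> y \<in> e \<Longrightarrow> \<rho>' e \<noteq> r"
    using kempe_swap_at[OF \<rho> y D2, where r = r] r S by blast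
  have x': "\<rho>' e \<noteq> s" if "e \<in> uedges G - {d}" "x \<in> e" for e
    using x[OF that] \<rho>'(2) that r S unfolding agree_off_def by auto
  \<comment> \<open>\<open>h1\<close> and \<open>h2\<close> complete the same
    \<open>\<rho>'\<close>, within the old and the new palette. The chain runs from
    \<open>h2\<close> through \<open>h1\<close> to \<open>h\<close>.\<close>
  obtain h1 where h1: "proper_on t (uedges G) h1" "agree_off S (uedges G - {d}) \<rho>' h1" "h1 d \<in> S" "h1 d \<noteq> t"
    "\<And>e. e \<in> uedges G - {d} \<Longrightarrow> h1 e = t \<longleftrightarrow> \<rho>' e = t"
    by (rule complete_coloring[OF A d \<rho>'(1) x' \<rho>'(3) S(1-4) r(1) S(5) r(2)]) (blast+)
  obtain h2 where h2: "proper_on t (uedges G) h2" "agree_off S' (uedges G - {d}) \<rho>' h2" "h2 d \<in> S'" "h2 d \<noteq> t"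
    "\<And>e. e \<in> uedges G - {d} \<Longrightarrow> h2 e = t \<longleftrightarrow> \<rho>' e = t"
    by (rule complete_coloring[OF A d \<rho>'(1) x' \<rho>'(3) S'(1-5) S(5) r(2)]) (blast+)
  have "agree_off S (uedges G) h1 h"
    using h1(2,3) h(2,3) \<rho>'(2) r S(3) unfolding agree_off_def by (metis Diff_iff insertE singletonD)
  then have "coloring_equivalent G t (q + 1) h1 f"
    using coloring_equivalent_step differ_at_mostI h1(1) h(1) finS S(2)
    by (metis order_refl proper_edge_coloring_iff)
  \<comment> \<open>The two palettes together have \<open>q + 2\<close> colors, but both completions
    have the class \<open>t\<close> of \<open>\<rho>'\<close>, so \<open>t\<close> can be left out
    and \<open>q + 1\<close> colors remain.\<close>
  moreover have "agree_off (insert a S - {t}) (uedges G) h2 h1"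
    unfolding agree_off_def
  proof
    fix e assume e: "e \<in> uedges G"
    show "h2 e = h1 e \<or> h2 e \<in> insert a S - {t} \<and> h1 e \<in> insert a S - {t}"
    proof (cases "e = d")
      case True then show ?thesis using h1(3,4) h2(3,4) by (auto simp: S'_def)
    next
      case False
      then have "e \<in> uedges G - {d}" using e by simp
      then have "\<rho>' e = h1 e \<or> \<rho>' e \<in> S \<and> h1 e \<in> S" "\<rho>' e = h2 e \<or> \<rho>' e \<in> insert a S \<and> h2 e \<in> insert a S"
        "h1 e = t \<longleftrightarrow> \<rho>' e = t" "h2 e = t \<longleftrightarrow> \<rho>' e = t"
        using h1(2,5) h2(2,5) unfolding agree_off_def S'_def by auto
      then show ?thesis by auto
    qed
  qed
  moreover have "card (insert a S - {t}) \<le> q + 1"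
    using S False finS by (simp add: card_Diff_subset)
  ultimately have "coloring_equivalent G t (q + 1) h2 f"
    using coloring_equivalent_step differ_at_mostI h2(1) finS
    by (metis finite_Diff finite_insert proper_edge_coloring_iff)
  moreover have "agree_off S' (uedges G - {d}) \<rho> h2"
    using h2(2) \<rho>'(2) S'(3,5) unfolding agree_off_def by (metis empty_iff insertE)
  ultimately show thesis using that S' h2(3) by blast
qed

section \<open>Switching color \<open>t\<close> along an alternating closed walk\<close>

text \<open>The cycle \<open>C\<close>, read from a chosen vertex in the direction whose first edge
  has color \<open>t\<close>. The assumption \<open>w_diff\<close> says that each edge lies in
  exactly one of the two classes \<open>t\<close>, that is, in \<open>diff_graph\<close>.\<close>

locale alternating_closed_walk =
  fixes E :: "'a set set" and t :: nat and f g :: "'a set \<Rightarrow> nat" and n :: nat and w :: "nat \<Rightarrow> 'a"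
  assumes f: "proper_on t E f" and g: "proper_on t E g"
    and n: "3 \<le> n" and w_inj: "inj_on w {..<n}" and w_closed: "w n = w 0"
    and w_edge: "i < n \<Longrightarrow> {w i, w (Suc i)} \<in> E"
    and w_diff: "i < n \<Longrightarrow> f {w i, w (Suc i)} = t \<longleftrightarrow> g {w i, w (Suc i)} \<noteq> t"
    and w_start: "f {w 0, w 1} = t"
begin

definition ed :: "nat \<Rightarrow> 'a set" where "ed i = {w i, w (Suc i)}"

lemma ed_in: "i < n \<Longrightarrow> ed i \<in> E"
  using w_edge by (simp add: ed_def)

lemma w_eq_iff: "i < n \<Longrightarrow> j < n \<Longrightarrow> w i = w j \<longleftrightarrow> i = j"
  using w_inj by (auto simp: inj_on_def)

text \<open>Two distinct edges at \<open>v\<close> cannot both have color \<open>t\<close> under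
  \<open>f\<close>. If neither had it, both would have it under \<open>g\<close>.\<close>

lemma incident_alternate:
  assumes "i < n" "j < n" "v \<in> ed i" "v \<in> ed j" "ed i \<noteq> ed j"
  shows "f (ed i) = t \<longleftrightarrow> f (ed j) \<noteq> t"
  using assms proper_onD[OF f ed_in ed_in, of i j v] proper_onD[OF g ed_in ed_in, of i j v]
    w_diff[of i] w_diff[of j] unfolding ed_def by metis

lemma ed_Suc_neq:
  assumes "Suc i < n"
  shows "ed i \<noteq> ed (Suc i)"
proof -
  have "w i \<noteq> w (Suc (Suc i))"
    using assms n w_eq_iff[of i "Suc (Suc i)"] w_eq_iff[of i 0] w_closed
    by (cases "Suc (Suc i) = n") auto
  moreover have "w i \<noteq> w (Suc i)" using assms w_eq_iff by simp
  ultimately show ?thesis unfolding ed_def by auto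
qed

lemma f_ed_iff: "i < n \<Longrightarrow> f (ed i) = t \<longleftrightarrow> even i"
proof (induction i)
  case 0 then show ?case using w_start by (simp add: ed_def)
next
  case (Suc i)
  then show ?case
    using incident_alternate[of i "Suc i" "w (Suc i)"] ed_Suc_neq[of i] by (simp add: ed_def)
qed

text \<open>The last edge meets \<open>ed 0\<close> at \<open>w 0\<close>, hence does not have color
  \<open>t\<close>, and so its index \<open>n - 1\<close> is odd.\<close>

lemma even_n: "even n"
proof -
  obtain m where m: "n = Suc m" using n by (cases n) auto
  have "w m \<notin> ed 0" using n m w_eq_iff[of m 0] w_eq_iff[of m 1] by (auto simp: ed_def)
  then have "ed m \<noteq> ed 0" by (auto simp: ed_def)
  moreover have "w 0 \<in> ed m" using w_closed m by (simp add: ed_def)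
  ultimately have "f (ed m) \<noteq> t"
    using incident_alternate[of m 0 "w 0"] f_ed_iff[of 0] n m by (simp add: ed_def)
  then show ?thesis using f_ed_iff[of m] m by simp
qed

text \<open>The two edges are the cyclically consecutive ones at the vertex, whose indices differ in
  parity; at \<open>w 0\<close> this relies on \<open>n\<close> being even.\<close>

lemma walk_vertex_edges:
  assumes "i < n" "v \<in> ed i"
  obtains j k where "j < n" "k < n" "v \<in> ed j" "v \<in> ed k" "f (ed j) = t" "f (ed k) \<noteq> t"
proof -
  have at_w: "\<exists>j<n. \<exists>k<n. w i \<in> ed j \<and> w i \<in> ed k \<and> f (ed j) = t \<and> f (ed k) \<noteq> t" if "i < n" for i
  proof (cases i)
    case 0
    obtain m where m: "n = Suc m" using n by (cases n) auto
    have "f (ed m) \<noteq> t" using f_ed_iff[of m] even_n m by simp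
    moreover have "w 0 \<in> ed m" using w_closed m by (simp add: ed_def)
    moreover have "f (ed 0) = t" "w 0 \<in> ed 0" using f_ed_iff[of 0] n by (auto simp: ed_def)
    ultimately show ?thesis using 0 m n by (metis lessI zero_less_Suc)
  next
    case (Suc m)
    have "f (ed i) = t \<longleftrightarrow> f (ed m) \<noteq> t" using f_ed_iff[of i] f_ed_iff[of m] that Suc by simp
    moreover have "w i \<in> ed i" "w i \<in> ed m" using Suc by (auto simp: ed_def)
    moreover have "m < n" using that Suc by simp
    ultimately show ?thesis using that by metis
  qed
  have "\<exists>l<n. v = w l"
  proof (cases "v = w i")
    case False
    then have "v = w (Suc i)" using assms by (simp add: ed_def)
    then show ?thesis using w_closed assms(1) n
      by (metis Suc_lessI gr0I less_nat_zero_code)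
  qed (use assms in blast)
  then show thesis using at_w that by metis
qed

text \<open>Edges that leave class \<open>t\<close> on the walk are not in class \<open>t\<close> of
  \<open>g\<close>, so no common edge is lost. Those that enter it are, and \<open>ed 1\<close> is
  one of them.\<close>

lemma card_common_class_less:
  assumes "finite E" "\<And>e. e \<in> E \<Longrightarrow> f' e = t \<longleftrightarrow> (f e = t) \<noteq> (e \<in> ed ` {..<n})"
  shows "card {e \<in> E. f e = t \<and> g e = t} < card {e \<in> E. f' e = t \<and> g e = t}"
proof (rule psubset_card_mono)
  have d: "f e = t \<longleftrightarrow> g e \<noteq> t" if "e \<in> ed ` {..<n}" for e
    using that w_diff by (auto simp: ed_def)
  have 1: "ed 1 \<in> ed ` {..<n}" "ed 1 \<in> E" "f (ed 1) \<noteq> t"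
    using n ed_in[of 1] f_ed_iff[of 1] by auto
  then have "f' (ed 1) = t" "g (ed 1) = t" using assms(2)[of "ed 1"] d[of "ed 1"] by auto
  moreover have "{e \<in> E. f e = t \<and> g e = t} \<subseteq> {e \<in> E. f' e = t \<and> g e = t}"
    using assms(2) d by auto
  ultimately show "{e \<in> E. f e = t \<and> g e = t} \<subset> {e \<in> E. f' e = t \<and> g e = t}"
    using 1 by blast
qed (use assms in simp)

text \<open>The case of few colors on the cycle. In the classes of \<open>S\<close>, removing
  \<open>N\<close> lowers the degree bound by one everywhere: at a vertex of the cycle
  \<open>N\<close> contains the cycle edge not colored \<open>t\<close>, at any other vertex the
  edge of color \<open>t\<close>, if there is one.\<close>

lemma switch_few_colors:
  assumes A: "G \<in> class_A q" and E: "E = uedges G" and t: "q + 1 \<le> t"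
    and few: "card (f ` ed ` {..<n}) \<le> q + 1"
  obtains f' where "proper_on t E f'" "coloring_equivalent G t (q + 1) f' f"
    "\<And>e. e \<in> E \<Longrightarrow> f' e = t \<longleftrightarrow> (f e = t) \<noteq> (e \<in> ed ` {..<n})"
proof -
  let ?C = "ed ` {..<n}"
  have CE: "?C \<subseteq> E" using ed_in by auto
  have fC: "f ` ?C \<subseteq> {1..t}" using proper_on_range[OF f] CE by blast
  obtain S where S: "f ` ?C \<subseteq> S" "S \<subseteq> {1..t}" "card S = q + 1"
    using exists_subset_between[OF few _ fC] t by auto
  have finS: "finite S" using S(2) finite_subset by blast
  have "f (ed 0) \<in> f ` ?C" "f (ed 0) = t" using n f_ed_iff[of 0] by auto
  then have tS: "t \<in> S" using S(1) by auto
  let ?Q = "S - {t}"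
  \<comment> \<open>\<open>N\<close> is the symmetric difference of class \<open>t\<close> and the
    cycle, the new class \<open>t\<close>. \<open>U\<close> collects the edges whose color is fixed
    in advance: \<open>t\<close> on \<open>N\<close>, the old color outside the palette.\<close>
  define N where "N = {e \<in> E. (f e = t) \<noteq> (e \<in> ?C)}"
  define U where "U = N \<union> {e \<in> E. f e \<notin> S}"
  define R where "R = {e \<in> E - N. f e \<in> S}"
  define \<sigma> where "\<sigma> e = (if e \<in> N then t else f e)" for e
  have onC: "\<exists>e1\<in>?C. \<exists>e2\<in>?C. v \<in> e1 \<and> v \<in> e2 \<and> f e1 = t \<and> f e2 \<noteq> t"
    if e: "e \<in> ?C" "v \<in> e" for e v
  proof -
    obtain i where "i < n" "v \<in> ed i" using e by auto
    then obtain j k where "j < n" "k < n" "v \<in> ed j" "v \<in> ed k" "f (ed j) = t" "f (ed k) \<noteq> t"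
      by (rule walk_vertex_edges)
    then show ?thesis by blast
  qed
  \<comment> \<open>\<open>N\<close> is a matching: on the cycle its edges have color
    \<open>t\<close> under \<open>g\<close>, off the cycle under \<open>f\<close>. The two kinds do
    not meet, as the \<open>f\<close>-edge of color \<open>t\<close> at a cycle vertex lies on the
    cycle.\<close>
  have N_once: "e = e'" if "e \<in> N" "e' \<in> N" "v \<in> e" "v \<in> e'" for e e' v
  proof -
    have mixed: False if "e \<in> N" "e' \<in> N" "v \<in> e" "v \<in> e'" "e \<in> ?C" "e' \<notin> ?C" for e e'
    proof -
      obtain e1 where "e1 \<in> ?C" "v \<in> e1" "f e1 = t" using onC \<open>e \<in> ?C\<close> \<open>v \<in> e\<close> by blast
      moreover have "e' \<in> E" "f e' = t" using that unfolding N_def by auto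
      ultimately show False using proper_onD[OF f, of e1 e' v] CE that by auto
    qed
    show ?thesis
    proof (cases "e \<in> ?C")
      case True
      then have e': "e' \<in> ?C" using mixed that by blast
      have "g e = t" "g e' = t"
        using True e' that w_diff unfolding N_def ed_def by auto
      then show ?thesis using proper_onD[OF g] that unfolding N_def by auto
    next
      case False
      then have "e' \<notin> ?C" using mixed that by blast
      then show ?thesis using False proper_onD[OF f] that unfolding N_def by auto
    qed
  qed
  have U_t: "e \<in> N" if "e \<in> U" "f e = t" for e
    using that tS unfolding U_def by auto
  have \<sigma>: "proper_on t U \<sigma>"
    unfolding proper_on_def
  proof (intro conjI ballI impI)
    show "\<sigma> \<in> U \<rightarrow> {1..t}"
      using proper_on_range[OF f] tS S(2) unfolding \<sigma>_def U_def by auto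
  next
    fix e e' assume e: "e \<in> U" "e' \<in> U" "e \<noteq> e' \<and> e \<inter> e' \<noteq> {}"
    then obtain v where "v \<in> e" "v \<in> e'" by blast
    then have "\<not> (e \<in> N \<and> e' \<in> N)" using N_once e by blast
    moreover have "e \<in> E" "e' \<in> E" using e unfolding U_def N_def by auto
    then have "f e \<noteq> f e'" using f e unfolding proper_on_def by blast
    ultimately show "\<sigma> e \<noteq> \<sigma> e'" using U_t e(1,2) unfolding \<sigma>_def by auto
  qed
  have \<sigma>Q: "\<sigma> e \<notin> ?Q" if "e \<in> U" for e using that unfolding \<sigma>_def U_def by auto
  have cQ: "card ?Q = q" using S(3) tS finS by simp
  have deg: "card {e \<in> R. v \<in> e} \<le> q" for v
  proof (cases "\<exists>e\<in>?C. v \<in> e")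
    case True
    then obtain e2 where e2: "e2 \<in> ?C" "v \<in> e2" "f e2 \<noteq> t" using onC by blast
    then have e2N: "e2 \<in> N" "e2 \<in> E" using CE unfolding N_def by auto
    have "card {e \<in> R. v \<in> e} \<le> card (S - {f e2})"
    proof (rule degree_le_colors[OF f, of _ v])
      fix e assume e: "e \<in> {e \<in> R. v \<in> e}"
      then have "f e \<noteq> f e2"
        using proper_onD[OF f, of e e2 v] e2 e2N unfolding R_def by auto
      then show "v \<in> e \<and> f e \<in> S - {f e2}" using e unfolding R_def by auto
    qed (use finS in \<open>auto simp: R_def\<close>)
    moreover have "f e2 \<in> S" using e2 S(1) by auto
    ultimately show ?thesis using S(3) finS by simp
  next
    case False
    have "card {e \<in> R. v \<in> e} \<le> card ?Q"
      by (rule degree_le_colors[OF f, of _ v]) (use False finS in \<open>auto simp: R_def N_def\<close>)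
    then show ?thesis using cQ by simp
  qed
  obtain h where h: "proper_on t (U \<union> R) h" "\<And>e. e \<in> U \<Longrightarrow> h e = \<sigma> e" "\<And>e. e \<in> R \<Longrightarrow> h e \<in> ?Q"
  proof (rule class_A_recolor[OF A _ deg cQ _ _ \<sigma> \<sigma>Q])
    show "R \<subseteq> uedges G" using E unfolding R_def by auto
    show "finite ?Q" "?Q \<subseteq> {1..t}" using finS S(2) by auto
    show "U \<inter> R = {}" unfolding U_def R_def by auto
  qed (blast+)
  have UR: "U \<union> R = E" unfolding U_def R_def N_def by auto
  have "h e = t \<longleftrightarrow> e \<in> N" if "e \<in> E" for e
  proof (cases "e \<in> U")
    case True then show ?thesis using h(2) U_t unfolding \<sigma>_def by auto
  next
    case False
    then have "e \<in> R" using UR that by blast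
    then show ?thesis using h(3)[of e] unfolding R_def by auto
  qed
  moreover have "agree_off S E h f"
    unfolding agree_off_def
  proof
    fix e assume "e \<in> E"
    then consider "e \<in> R" | "e \<in> N" | "e \<in> U" "e \<notin> N" using UR by blast
    then show "h e = f e \<or> h e \<in> S \<and> f e \<in> S"
    proof cases
      case 1 then show ?thesis using h(3)[of e] unfolding R_def by auto
    next
      case 2
      then have "h e = t" "f e \<in> S" using h(2)[of e] S(1) tS unfolding U_def \<sigma>_def N_def by auto
      then show ?thesis using tS by simp
    next
      case 3 then show ?thesis using h(2)[of e] unfolding \<sigma>_def by auto
    qed
  qed
  then have "differ_at_most G t (q + 1) h f"
    using differ_at_mostI[of S G h f] finS S(3) E by simp
  then have "coloring_equivalent G t (q + 1) h f"
    using coloring_equivalent_step coloring_equivalent_refl f h(1) UR E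
    by (metis proper_edge_coloring_iff)
  ultimately show thesis using that h(1) UR unfolding N_def by auto
qed

text \<open>The state in which \<open>ed (2 * k)\<close> is uncolored: the even edges before it have
  lost \<open>t\<close>, the odd ones have received it. For \<open>k = 0\<close> this is
  \<open>f\<close> without the first edge.\<close>

definition partial_switch :: "nat \<Rightarrow> ('a set \<Rightarrow> nat) \<Rightarrow> bool" where
  "partial_switch k \<rho> \<longleftrightarrow> proper_on t (E - {ed (2 * k)}) \<rho> \<and>
     (\<forall>e\<in>E - {ed (2 * k)}. \<rho> e = t \<longleftrightarrow> (f e = t) \<noteq> (e \<in> ed ` {..2 * k}))"

text \<open>The vertex \<open>v\<close> is an end of the switched path. Its original edge of color
  \<open>t\<close> is an even edge of the path and has left the class, while the odd edges of the
  path avoid both ends.\<close>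

lemma partial_switch_missing:
  assumes \<rho>: "partial_switch k \<rho>" and k: "2 * k + 2 \<le> n" and e: "e \<in> E - {ed (2 * k)}" "v \<in> e"
    and v: "v = w (2 * k + 1) \<or> v = w 0"
  shows "\<rho> e \<noteq> t"
proof
  assume "\<rho> e = t"
  then have "(f e = t) \<noteq> (e \<in> ed ` {..2 * k})" using \<rho> e unfolding partial_switch_def by blast
  moreover have "e \<in> ed ` {..2 * k}" if "f e = t"
  proof -
    have "e = ed (2 * k) \<or> e = ed 0"
      using v proper_onD[OF f, of e "ed (2 * k)" v] proper_onD[OF f, of e "ed 0" v] e that
        f_ed_iff[of "2 * k"] f_ed_iff[of 0] k ed_in[of "2 * k"] ed_in[of 0] by (auto simp: ed_def)
    then show ?thesis by auto
  qed
  ultimately obtain i where i: "i \<le> 2 * k" "e = ed i" "f (ed i) \<noteq> t" by auto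
  then have "odd i" using f_ed_iff[of i] k by auto
  then have "i < 2 * k" "0 < i" using i by (auto intro: le_neq_trans simp: odd_pos)
  then show False
    using e(2) i(2) v k w_eq_iff[of "2 * k + 1" i] w_eq_iff[of "2 * k + 1" "Suc i"]
      w_eq_iff[of 0 i] w_eq_iff[of 0 "Suc i"] by (auto simp: ed_def)
qed

text \<open>The invariant of the trip around the cycle. As \<open>\<rho>\<close> does not color all
  of \<open>G\<close>, equivalence to \<open>f\<close> is carried by a completion \<open>h\<close>
  within \<open>S\<close>. The palette also holds the free color \<open>s\<close> and the color of
  the next edge, as \<open>shift_uncolored\<close> requires.\<close>

lemma partial_switch_state:
  assumes A: "G \<in> class_A q" and E: "E = uedges G" and q: "3 \<le> q" and t: "q + 1 \<le> t"
    and c: "c \<in> {1..t}" "\<forall>e\<in>E. w 0 \<in> e \<longrightarrow> f e \<noteq> c"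
  shows "2 * k + 2 \<le> n \<Longrightarrow> \<exists>\<rho> s S h. partial_switch k \<rho> \<and>
    (\<forall>e\<in>E - {ed (2 * k)}. w (2 * k) \<in> e \<longrightarrow> \<rho> e \<noteq> s) \<and>
    S \<subseteq> {1..t} \<and> card S = q + 1 \<and> t \<in> S \<and> s \<in> S \<and> s \<noteq> t \<and> \<rho> (ed (2 * k + 1)) \<in> S \<and>
    coloring_equivalent G t (q + 1) h f \<and> agree_off S (E - {ed (2 * k)}) \<rho> h \<and> h (ed (2 * k)) \<in> S"
proof (induction k)
  case 0
  have 0: "f (ed 0) = t" "ed 0 \<in> E" "w 0 \<in> ed 0" using f_ed_iff[of 0] ed_in[of 0] n by (auto simp: ed_def)
  have ct: "c \<noteq> t" using c(2) 0 by blast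
  have 1: "ed 1 \<in> E" using ed_in[of 1] n by simp
  \<comment> \<open>Initially \<open>f\<close> is its own completion, with the missing color
    \<open>c\<close> in the role of \<open>s\<close>.\<close>
  have "card {t, c, f (ed 1)} \<le> q + 1" using q card_insert_le_m1[of 3 "{c, f (ed 1)}" t] by (simp add: card_insert_if)
  moreover have "{t, c, f (ed 1)} \<subseteq> {1..t}" using c(1) t proper_on_range[OF f 1] by auto
  ultimately obtain S where S: "{t, c, f (ed 1)} \<subseteq> S" "S \<subseteq> {1..t}" "card S = q + 1"
    using exists_subset_between[of "{t, c, f (ed 1)}" "q + 1" "{1..t}"] t by auto
  have "partial_switch 0 f"
    using proper_on_subset[OF f, of "E - {ed 0}"] 0 unfolding partial_switch_def by auto
  moreover have "coloring_equivalent G t (q + 1) f f"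
    using coloring_equivalent_refl f E by (simp add: proper_edge_coloring_iff)
  ultimately show ?case
    using S ct 0 c(2) by (intro exI[of _ f] exI[of _ c] exI[of _ S]) (auto simp: agree_off_def)
next
  case (Suc k)
  let ?d = "ed (2 * k)" and ?e = "ed (2 * k + 1)" and ?d' = "ed (2 * k + 2)" and ?e' = "ed (2 * k + 3)"
  have k: "2 * k + 4 \<le> n" and k2: "2 * k + 2 \<le> n" using Suc.prems by simp_all
  obtain \<rho> s S h where \<rho>: "partial_switch k \<rho>"
    and s0: "\<forall>e\<in>E - {?d}. w (2 * k) \<in> e \<longrightarrow> \<rho> e \<noteq> s"
    and S: "S \<subseteq> {1..t}" "card S = q + 1" "t \<in> S" "s \<in> S" "s \<noteq> t" and eS: "\<rho> ?e \<in> S"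
    and h: "coloring_equivalent G t (q + 1) h f" "agree_off S (E - {?d}) \<rho> h" "h ?d \<in> S"
    using Suc.IH[OF k2] by (elim exE conjE)
  have s: "\<rho> e \<noteq> s" if "e \<in> E - {?d}" "w (2 * k) \<in> e" for e
    using s0 that by blast
  have y: "\<rho> e \<noteq> t" if "e \<in> E - {?d}" "w (2 * k + 1) \<in> e" for e
    using partial_switch_missing[OF \<rho> _ that] k by simp
  have \<rho>p: "proper_on t (E - {?d}) \<rho>"
    and \<rho>t: "\<And>e. e \<in> E - {?d} \<Longrightarrow> \<rho> e = t \<longleftrightarrow> (f e = t) \<noteq> (e \<in> ed ` {..2 * k})"
    using \<rho> unfolding partial_switch_def by auto
  have in_E: "?d \<in> E" "?e \<in> E" "?d' \<in> E" "?e' \<in> E" using ed_in k by auto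
  have wz: "w (2 * k + 2) \<noteq> w i" if "i \<le> 2 * k + 1" for i
    using w_eq_iff[of "2 * k + 2" i] that k by auto
  have d'_new: "?d' \<notin> ed ` {..2 * k}"
  proof
    assume "?d' \<in> ed ` {..2 * k}"
    then obtain i where "i \<le> 2 * k" "w (2 * k + 2) \<in> ed i" by (auto simp: ed_def)
    then show False using wz[of i] wz[of "Suc i"] by (auto simp: ed_def)
  qed
  then have d'd: "?d' \<noteq> ?d" by auto
  \<comment> \<open>The next even edge has not been switched yet. It is the only edge of color
    \<open>t\<close> at \<open>w (2 * k + 2)\<close>, so it becomes the uncolored edge.\<close>
  have d't: "\<rho> ?d' = t" using \<rho>t[of ?d'] d'_new d'd in_E f_ed_iff[of "2 * k + 2"] k by auto
  have zd: "w (2 * k + 2) \<notin> ?d" using wz by (auto simp: ed_def)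
  have zd': "w (2 * k + 2) \<in> ?d'" by (simp add: ed_def)
  have d'E: "?d' \<in> E - {?d}" using d'd in_E by blast
  have "e' = ?d'" if "e' \<in> E - {?d}" "\<rho> e' = t" "w (2 * k + 2) \<in> e'" for e'
    by (rule proper_onD[OF \<rho>p that(1) d'E that(3) zd']) (use that(2) d't in metis)
  then have B: "{?d'} = {e' \<in> E - {?d}. \<rho> e' = t \<and> w (2 * k + 2) \<in> e'}"
    using d'E d't zd' by blast
  have ed_d: "?d = {w (2 * k), w (2 * k + 1)}" and ed_e: "?e = {w (2 * k + 1), w (2 * k + 2)}"
    by (auto simp: ed_def)
  have ed': "?e \<noteq> ?d" using zd ed_e by auto
  obtain \<rho>' where \<rho>': "proper_on t (E - {?d'}) \<rho>'" "\<rho>' ?d \<in> S" "agree_off S (E - {?d'} - {?d}) \<rho> \<rho>'"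
    "\<And>e. e \<in> E - {?d'} \<Longrightarrow> \<rho>' e = t \<longleftrightarrow> e = ?e \<or> (e \<noteq> ?d \<and> \<rho> e = t)"
    and s'0: "w (2 * k + 2) \<notin> ?d \<Longrightarrow> \<exists>s'\<in>S - {t}. \<forall>e\<in>E - {?d'}. w (2 * k + 2) \<in> e \<longrightarrow> \<rho>' e \<noteq> s'"
    by (rule shift_uncolored[where \<rho> = \<rho>, OF A _ ed_d _ _ _ S _ ed' ed_e eS, folded E, OF in_E(1) \<rho>p s y in_E(2) B])
      (blast+)
  obtain s' where s': "s' \<in> S" "s' \<noteq> t" "\<And>e. e \<in> E - {?d'} \<Longrightarrow> w (2 * k + 2) \<in> e \<Longrightarrow> \<rho>' e \<noteq> s'"
    using s'0[OF zd] by auto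
  have "{..2 * Suc k} = insert (2 * k + 2) (insert (2 * k + 1) {..2 * k})" by auto
  then have im: "ed ` {..2 * Suc k} = insert ?d' (insert ?e (ed ` {..2 * k}))" by simp
  have fed: "f ?e \<noteq> t" "f ?d = t" "?d \<in> ed ` {..2 * k}"
    using f_ed_iff[of "2 * k + 1"] f_ed_iff[of "2 * k"] k by simp_all
  have "\<rho>' e = t \<longleftrightarrow> (f e = t) \<noteq> (e \<in> ed ` {..2 * Suc k})" if "e \<in> E - {?d'}" for e
  proof (cases "e = ?e \<or> e = ?d")
    case True then show ?thesis using \<rho>'(4)[OF that] fed ed' unfolding im by (metis insert_iff)
  next
    case False
    then have "\<rho> e = t \<longleftrightarrow> (f e = t) \<noteq> (e \<in> ed ` {..2 * k})" using \<rho>t that by blast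
    then show ?thesis using \<rho>'(4)[OF that] False that unfolding im by blast
  qed
  then have ps: "partial_switch (Suc k) \<rho>'" using \<rho>'(1) unfolding partial_switch_def by simp
  have y': "\<rho>' e \<noteq> t" if "e \<in> E - {?d'}" "w (2 * k + 3) \<in> e" for e
    using partial_switch_missing[OF ps _ _ that(2)] that(1) k by (simp add: eval_nat_numeral)
  \<comment> \<open>The shift moves colors only within \<open>S\<close>, so the old \<open>h\<close>
    also completes \<open>\<rho>'\<close>. It remains to bring the color of \<open>?e'\<close> into
    the palette.\<close>
  have ag: "agree_off S (E - {?d'}) \<rho>' h"
    using \<rho>'(2,3) h(2,3) unfolding agree_off_def by (metis Diff_iff singletonD)
  have hd': "h ?d' \<in> S"
    using h(2) in_E d'd d't S(3) unfolding agree_off_def by (metis Diff_iff singletonD)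
  have ed_d': "?d' = {w (2 * k + 2), w (2 * k + 3)}" and ed_e': "?e' = {w (2 * k + 3), w (2 * k + 4)}"
    by (auto simp: ed_def eval_nat_numeral)
  have "?d' \<noteq> ?e'" using ed_Suc_neq[of "2 * k + 2"] k by (simp add: eval_nat_numeral)
  then have e't: "\<rho>' ?e' \<in> {1..t}" using proper_on_range[OF \<rho>'(1)] in_E by blast
  obtain S' h' where "S' \<subseteq> {1..t}" "card S' = q + 1" "t \<in> S'" "s' \<in> S'" "\<rho>' ?e' \<in> S'"
    "coloring_equivalent G t (q + 1) h' f" "agree_off S' (E - {?d'}) \<rho>' h'" "h' ?d' \<in> S'"
    by (rule change_palette[where \<rho> = \<rho>', OF A q _ ed_d' _ _ _ S(1-3) s'(1,2) h(1) _ hd', folded E,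
          OF in_E(3) \<rho>'(1) s'(3) y' ag e't]) (blast+)
  then show ?case using ps s'
    by (intro exI[of _ \<rho>'] exI[of _ s'] exI[of _ S'] exI[of _ h'])
      (simp add: eval_nat_numeral)
qed

text \<open>After the trip the last odd edge returns to \<open>w 0\<close>, where \<open>t\<close>
  is missing. The final shift therefore leaves no edge uncolored.\<close>

lemma switch_deficient_vertex:
  assumes A: "G \<in> class_A q" and E: "E = uedges G" and q: "3 \<le> q" and t: "q + 1 \<le> t"
    and c: "c \<in> {1..t}" "\<forall>e\<in>E. w 0 \<in> e \<longrightarrow> f e \<noteq> c"
  obtains f' where "proper_on t E f'" "coloring_equivalent G t (q + 1) f' f"
    "\<And>e. e \<in> E \<Longrightarrow> f' e = t \<longleftrightarrow> (f e = t) \<noteq> (e \<in> ed ` {..<n})"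
proof -
  obtain k where k: "n = 2 * k + 2"
    by (rule that[of "n div 2 - 1"]) (use even_n n in presburger)
  let ?d = "ed (2 * k)" and ?e = "ed (2 * k + 1)"
  obtain \<rho> s S h where \<rho>: "partial_switch k \<rho>"
    and s0: "\<forall>e\<in>E - {?d}. w (2 * k) \<in> e \<longrightarrow> \<rho> e \<noteq> s"
    and S: "S \<subseteq> {1..t}" "card S = q + 1" "t \<in> S" "s \<in> S" "s \<noteq> t" and eS: "\<rho> ?e \<in> S"
    and h: "coloring_equivalent G t (q + 1) h f" "agree_off S (E - {?d}) \<rho> h" "h ?d \<in> S"
    using partial_switch_state[OF A E q t c eq_refl[OF k[symmetric]]] by (elim exE conjE)
  have s: "\<rho> e \<noteq> s" if "e \<in> E - {?d}" "w (2 * k) \<in> e" for e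
    using s0 that by blast
  have y: "\<rho> e \<noteq> t" if "e \<in> E - {?d}" "w (2 * k + 1) \<in> e \<or> w 0 \<in> e" for e
    using partial_switch_missing[OF \<rho> _ that(1)] that(2) k by auto
  have \<rho>p: "proper_on t (E - {?d}) \<rho>"
    and \<rho>t: "\<And>e. e \<in> E - {?d} \<Longrightarrow> \<rho> e = t \<longleftrightarrow> (f e = t) \<noteq> (e \<in> ed ` {..2 * k})"
    using \<rho> unfolding partial_switch_def by auto
  have in_E: "?d \<in> E" "?e \<in> E" using ed_in k by auto
  have ed_d: "?d = {w (2 * k), w (2 * k + 1)}" and ed_e: "?e = {w (2 * k + 1), w 0}"
    using w_closed k by (auto simp: ed_def)
  have ed': "?e \<noteq> ?d" using ed_Suc_neq[of "2 * k"] k by simp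
  have B: "{} = {e' \<in> uedges G - {?d}. \<rho> e' = t \<and> w 0 \<in> e'}" using y E by blast
  obtain f' where f': "proper_on t E f'" "f' ?d \<in> S" "agree_off S (E - {?d}) \<rho> f'"
    "\<And>e. e \<in> E \<Longrightarrow> f' e = t \<longleftrightarrow> e = ?e \<or> (e \<noteq> ?d \<and> \<rho> e = t)"
    by (rule shift_uncolored[where \<rho> = \<rho>, OF A _ ed_d _ _ _ S _ ed' ed_e eS B, folded E, unfolded Diff_empty,
          OF in_E(1) \<rho>p s y in_E(2)]) (blast+)
  have "agree_off S E f' h"
    using f'(2,3) h(2,3) unfolding agree_off_def by (metis Diff_iff singletonD)
  then have "differ_at_most G t (q + 1) f' h"
    using differ_at_mostI[of S G f' h] finite_subset[OF S(1)] S(2) E by simp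
  then have f'_equiv: "coloring_equivalent G t (q + 1) f' f"
    using coloring_equivalent_step h(1) f'(1) E by (metis proper_edge_coloring_iff)
  have "{..<n} = insert (2 * k + 1) {..2 * k}" using k by auto
  then have im: "ed ` {..<n} = insert ?e (ed ` {..2 * k})" by simp
  have fed: "f ?e \<noteq> t" "f ?d = t" "?d \<in> ed ` {..2 * k}"
    using f_ed_iff[of "2 * k + 1"] f_ed_iff[of "2 * k"] k by simp_all
  have "f' e = t \<longleftrightarrow> (f e = t) \<noteq> (e \<in> ed ` {..<n})" if "e \<in> E" for e
  proof (cases "e = ?e \<or> e = ?d")
    case True then show ?thesis using f'(4)[OF that] fed ed' unfolding im by (metis insert_iff)
  next
    case False
    then have "\<rho> e = t \<longleftrightarrow> (f e = t) \<noteq> (e \<in> ed ` {..2 * k})" using \<rho>t that by blast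
    then show ?thesis using f'(4)[OF that] False unfolding im by blast
  qed
  then show thesis using that f'(1) f'_equiv by blast
qed

end

section \<open>From the cycle to a walk, and the conclusion\<close>

text \<open>The bounds say that \<open>x\<close> and \<open>y\<close> differ by less than
  \<open>n\<close>; this form suits offsets from \<open>0..n-1\<close> as well as from
  \<open>1..n\<close>, the range of the backward walk.\<close>

lemma mod_add_cancel:
  fixes a x y n :: nat
  assumes "(a + x) mod n = (a + y) mod n" "x < y + n" "y < x + n"
  shows "x = y"
  using assms
proof (induction x y rule: linorder_wlog)
  case (le x y)
  then have "n dvd (a + y) - (a + x)" by (metis add_le_cancel_left mod_eq_dvd_iff_nat)
  then show ?case using le by (auto dest: dvd_imp_le)
next
  case (sym x y) then show ?case by simp
qed

lemma cycle_edge_mod: "cycle_edge C (i mod length C) = cycle_edge C i"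
  by (simp add: cycle_edge_def mod_Suc_eq)

lemma cycle_edge_in: "C \<noteq> [] \<Longrightarrow> cycle_edge C i \<in> cycle_edges C"
  unfolding cycle_edges_def
  by (rule image_eqI[of _ _ "i mod length C"]) (auto simp: cycle_edge_mod)

text \<open>One of the two cycle edges at \<open>v\<close> has color \<open>t\<close> by
  alternation, and the walk starts along that one, forward or backward.\<close>

lemma walk_from_cycle:
  assumes f: "proper_edge_coloring G t f" and g: "proper_edge_coloring G t g"
    and C: "cycle_in (diff_graph G f g t) C" "alternating_cycle f t C" and v: "v \<in> set C"
  obtains w where "alternating_closed_walk (uedges G) t f g (length C) w" "w 0 = v"
    "\<And>i. i < length C \<Longrightarrow> {w i, w (Suc i)} \<in> cycle_edges C"
proof -
  let ?n = "length C"
  have n: "3 \<le> ?n" and dC: "distinct C" and CE: "cycle_edges C \<subseteq> sym_diff (color_class G f t) (color_class G g t)"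
    using C(1) unfolding cycle_in_def diff_graph_def Let_def by auto
  have Cn: "C \<noteq> []" using n by auto
  have eC: "e \<in> uedges G" "f e = t \<longleftrightarrow> g e \<noteq> t" if "e \<in> cycle_edges C" for e
    using that CE unfolding color_class_def by auto
  obtain a where a: "a < ?n" "C ! a = v" using v by (metis in_set_conv_nth)
  have nth_eq: "C ! (i mod ?n) = C ! (j mod ?n) \<longleftrightarrow> i mod ?n = j mod ?n" for i j
    using dC Cn by (simp add: nth_eq_iff_index_eq)
  show thesis
  proof (cases "f (cycle_edge C a) = t")
    case True
    define w where "w i = C ! ((a + i) mod ?n)" for i
    have ed: "{w i, w (Suc i)} = cycle_edge C (a + i)" for i
      by (simp add: w_def cycle_edge_def)
    have "inj_on w {..<?n}"
    proof (rule inj_onI)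
      fix i j assume ij: "i \<in> {..<?n}" "j \<in> {..<?n}" "w i = w j"
      show "i = j"
        by (rule mod_add_cancel[of a i ?n j]) (use ij nth_eq[of "a + i" "a + j"] in \<open>auto simp: w_def\<close>)
    qed
    moreover have wC: "{w i, w (Suc i)} \<in> cycle_edges C" for i
      unfolding ed by (rule cycle_edge_in[OF Cn])
    moreover have "w ?n = w 0" by (simp add: w_def)
    moreover have "f {w 0, w 1} = t" using ed[of 0] True by simp
    ultimately have "alternating_closed_walk (uedges G) t f g ?n w"
      unfolding alternating_closed_walk_def
      using f g n eC by (simp add: proper_edge_coloring_iff)
    moreover have "w 0 = v" using a by (simp add: w_def)
    ultimately show thesis using that wC by blast
  next
    case False
    \<comment> \<open>Backward reading; writing \<open>a + (?n - i)\<close> avoids truncated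
      subtraction.\<close>
    define w where "w i = C ! ((a + (?n - i)) mod ?n)" for i
    have ed: "{w i, w (Suc i)} = cycle_edge C (a + (?n - Suc i))" if "i < ?n" for i
      using that by (auto simp: w_def cycle_edge_def Suc_diff_Suc simp flip: add_Suc_right)
    have "inj_on w {..<?n}"
    proof (rule inj_onI)
      fix i j assume ij: "i \<in> {..<?n}" "j \<in> {..<?n}" "w i = w j"
      have "?n - i = ?n - j"
        by (rule mod_add_cancel[of a _ ?n])
          (use ij nth_eq[of "a + (?n - i)" "a + (?n - j)"] in \<open>auto simp: w_def\<close>)
      then show "i = j" using ij by auto
    qed
    moreover have wC: "{w i, w (Suc i)} \<in> cycle_edges C" if "i < ?n" for i
      unfolding ed[OF that] by (rule cycle_edge_in[OF Cn])
    moreover have "w ?n = w 0" by (simp add: w_def)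
    moreover have "f {w 0, w 1} = t"
    proof -
      \<comment> \<open>The index before \<open>a\<close>: alternation there says that one of the
        cycle edges at \<open>v\<close> has color \<open>t\<close>, and it is not the forward
        one.\<close>
      let ?i = "(a + (?n - 1)) mod ?n"
      have "Suc (a + (?n - 1)) = a + ?n" using n by simp
      then have "Suc ?i mod ?n = a" using a(1) by (simp add: mod_Suc_eq)
      then have "cycle_edge C (Suc ?i) = cycle_edge C a" by (metis cycle_edge_mod)
      moreover have "cycle_edge C ?i = {w 0, w 1}"
        unfolding cycle_edge_mod using ed[of 0] Cn by simp
      moreover have "?i < ?n" using Cn by simp
      ultimately show ?thesis using C(2) False unfolding alternating_cycle_def by metis
    qed
    ultimately have "alternating_closed_walk (uedges G) t f g ?n w"
      unfolding alternating_closed_walk_def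
      using f g n eC by (simp add: proper_edge_coloring_iff)
    moreover have "w 0 = v" using a by (simp add: w_def)
    ultimately show thesis using that wC by blast
  qed
qed

lemma missing_color:
  assumes v: "card {e \<in> D. v \<in> e} < t" and D: "finite D"
  obtains c where "c \<in> {1..t}" "\<forall>e\<in>D. v \<in> e \<longrightarrow> f e \<noteq> c"
proof -
  let ?D = "{e \<in> D. v \<in> e}"
  have "card (f ` ?D) < card {1..t}" using card_image_le[of ?D f] v D by simp
  then have "\<not> {1..t} \<subseteq> f ` ?D" using D card_mono[of "f ` ?D" "{1..t}"] by auto
  then show thesis using that by blast
qed

theorem lemma3p3:
  fixes G :: "'a ugraph" and q t :: nat and f g :: "'a set \<Rightarrow> nat" and C :: "'a list"
  assumes "q \<ge> 3"
    and "G \<in> class_A q"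
    and "max_udegree G = t"
    and "t \<ge> q + 2"
    and "proper_edge_coloring G t f"
    and "proper_edge_coloring G t g"
    and "cycle_in (diff_graph G f g t) C"
    and "alternating_cycle f t C"
    and "card (f ` cycle_edges C) \<le> q + 1 \<or> (\<exists>v\<in>set C. udegree G v < t)"
  shows "\<exists>f'. proper_edge_coloring G t f' \<and>
           coloring_equivalent G t (q + 1) f' f \<and>
           card (color_class G f' t \<inter> color_class G g t) >
             card (color_class G f t \<inter> color_class G g t)"
proof -
  let ?E = "uedges G"
  have t: "q + 1 \<le> t" using assms(4) by simp
  have fin: "finite ?E" using assms(2) finite_uedges unfolding class_A_def by blast
  have cc: "color_class G a t \<inter> color_class G b t = {e \<in> ?E. a e = t \<and> b e = t}" for a b
    unfolding color_class_def by auto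
  have "\<exists>w f'. alternating_closed_walk ?E t f g (length C) w \<and> proper_on t ?E f' \<and>
      coloring_equivalent G t (q + 1) f' f \<and>
      (\<forall>e\<in>?E. f' e = t \<longleftrightarrow> (f e = t) \<noteq> (e \<in> alternating_closed_walk.ed w ` {..<length C}))"
    using assms(9)
  proof
    assume few: "card (f ` cycle_edges C) \<le> q + 1"
    \<comment> \<open>With few colors any starting vertex will do.\<close>
    have "C ! 0 \<in> set C" using assms(7) unfolding cycle_in_def by (intro nth_mem) linarith
    then obtain w where w: "alternating_closed_walk ?E t f g (length C) w"
      "\<And>i. i < length C \<Longrightarrow> {w i, w (Suc i)} \<in> cycle_edges C"
      using walk_from_cycle[OF assms(5-8)] by metis
    interpret alternating_closed_walk ?E t f g "length C" w by (rule w)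
    have "f ` ed ` {..<length C} \<subseteq> f ` cycle_edges C" using w(2) by (auto simp: ed_def)
    moreover have "finite (f ` cycle_edges C)" by (simp add: cycle_edges_def)
    ultimately have "card (f ` ed ` {..<length C}) \<le> q + 1" using few by (meson card_mono le_trans)
    from switch_few_colors[OF assms(2) refl t this] show ?thesis using w(1) by metis
  next
    assume "\<exists>v\<in>set C. udegree G v < t"
    then obtain v where v: "v \<in> set C" "udegree G v < t" by blast
    obtain c where c: "c \<in> {1..t}" "\<forall>e\<in>?E. v \<in> e \<longrightarrow> f e \<noteq> c"
      using missing_color[OF v(2)[unfolded udegree_def] fin] by blast
    obtain w where w: "alternating_closed_walk ?E t f g (length C) w" "w 0 = v"
      using walk_from_cycle[OF assms(5-8) v(1)] by metis
    interpret alternating_closed_walk ?E t f g "length C" w by (rule w)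
    show ?thesis
      using switch_deficient_vertex[OF assms(2) refl assms(1) t c(1) c(2)[folded w(2)]] w(1) by metis
  qed
  then obtain w f' where w: "alternating_closed_walk ?E t f g (length C) w"
    and f': "proper_on t ?E f'" "coloring_equivalent G t (q + 1) f' f"
      "\<And>e. e \<in> ?E \<Longrightarrow> f' e = t \<longleftrightarrow> (f e = t) \<noteq> (e \<in> alternating_closed_walk.ed w ` {..<length C})"
    by blast
  interpret alternating_closed_walk ?E t f g "length C" w by (rule w)
  show ?thesis
    using card_common_class_less[OF fin f'(3)] f'(1,2) unfolding cc proper_edge_coloring_iff by blast
qed

end
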